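(* Let $I\subset S=K[x_1,\ldots,x_n]$ be a nonzero monomial ideal generated by $m$ elements. Then $$\operatorname{sdepth}I\ge\max\{1,n-m+1\}.$$
   Context: $K$ is a field and $S=K[x_1,\ldots,x_n]$, $n\ge1$, with its $\mathbb{Z}^n$-grading. For a nonzero finitely generated $\mathbb{Z}^n$-graded $S$-module $M$, a homogeneous $u\in M$ and $Z\subset\{x_1,\ldots,x_n\}$, $uK[Z]$ denotes the $K$-subspace of $M$ generated by all $uv$ with $v$ a monomial in $K[Z]$; it is a Stanley space of dimension $|Z|$ if it is a free $K[Z]$-module. A Stanley decomposition of $M$ is a presentation $\mathcal{D}: M=\bigoplus_{i=1}^m u_iK[Z_i]$ of $M$ as a finite direct sum of Stanley spaces, as $\mathbb{Z}^n$-graded $K$-vector spaces; $\operatorname{sdepth}\mathcal{D}=\min\{|Z_i|\}$, and $\operatorname{sdepth}M$ is the maximum of $\operatorname{sdepth}\mathcal{D}$ over all Stanley decompositions $\mathcal{D}$ of $M$. *)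

theory Defs
  imports Complex_Main "HOL-Library.Poly_Mapping" "HOL-Library.FuncSet" "HOL-Library.Cardinality"
begin

text \<open>
  The polynomial ring \<open>S = K[x\<^sub>1,\<dots>,x\<^sub>n]\<close> is the type \<open>('n, 'k) pring\<close>: the variables are the elements
  of the finite type \<open>'n\<close>, so \<open>n = CARD('n)\<close> is at least 1, a monomial is given by its exponent vector
  \<open>'n \<Rightarrow>\<^sub>0 nat\<close>, and the product of \<^theory>\<open>HOL-Library.Poly_Mapping\<close> is the product of polynomials.
\<close>

type_synonym ('n, 'k) pring = "('n \<Rightarrow>\<^sub>0 nat) \<Rightarrow>\<^sub>0 'k"

definition xpow :: "('n \<Rightarrow>\<^sub>0 nat) \<Rightarrow> ('n, 'k::field) pring" where
  "xpow b = Poly_Mapping.single b 1"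

definition const :: "'k \<Rightarrow> ('n, 'k::field) pring" where
  "const c = Poly_Mapping.single 0 c"

definition mdeg :: "('n \<Rightarrow>\<^sub>0 nat) \<Rightarrow> 'n \<Rightarrow> int" where
  "mdeg b = (\<lambda>i. int (Poly_Mapping.lookup b i))"

text \<open>The subring \<open>K[Z]\<close> of \<open>S\<close>.\<close>

definition poly_subring :: "'n set \<Rightarrow> ('n, 'k::field) pring set" where
  "poly_subring Z = {p. \<forall>b\<in>Poly_Mapping.keys p. Poly_Mapping.keys b \<subseteq> Z}"

text \<open>
  The \<open>S\<close>-module is a submodule \<open>M\<close> of a type \<open>'m\<close> carrying an \<open>S\<close>-module structure; \<open>gr a\<close> is the
  component of \<open>M\<close> of degree \<open>a \<in> \<int>\<^sup>n\<close>.
\<close>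

locale multigraded_module = module scale
  for scale :: "('n::finite, 'k::field) pring \<Rightarrow> 'm::ab_group_add \<Rightarrow> 'm" +
  fixes gr :: "('n \<Rightarrow> int) \<Rightarrow> 'm set" and M :: "'m set"
  assumes submodule: "module.subspace scale M"
    and nonzero: "M \<noteq> {0}"
    and finitely_generated: "\<exists>G. finite G \<and> M = module.span scale G"
    and component_subset: "gr a \<subseteq> M"
    and component_subspace: "module.subspace (\<lambda>c. scale (const c)) (gr a)"
    and direct_sum_components:
      "x \<in> M \<Longrightarrow> \<exists>!h. finite {a. h a \<noteq> 0} \<and> (\<forall>a. h a \<in> gr a) \<and> x = (\<Sum>a | h a \<noteq> 0. h a)"
    and component_shift: "x \<in> gr a \<Longrightarrow> scale (xpow b) x \<in> gr (\<lambda>i. a i + mdeg b i)"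
begin

definition homogeneous :: "'m \<Rightarrow> bool" where
  "homogeneous u \<longleftrightarrow> (\<exists>a. u \<in> gr a)"

text \<open>\<open>u K[Z]\<close>\<close>

definition stanley_span :: "'m \<Rightarrow> 'n set \<Rightarrow> 'm set" where
  "stanley_span u Z = module.span (\<lambda>c. scale (const c))
    {scale (xpow b) u | b. Poly_Mapping.keys b \<subseteq> Z}"

text \<open>
  \<open>R\<close> is a subring of \<open>S\<close> and \<open>N\<close> an \<open>R\<close>-submodule; \<open>N\<close> is free over \<open>R\<close> if it has a basis \<open>B\<close>, that is,
  each element of \<open>N\<close> is a finite linear combination of \<open>B\<close> with unique coefficients in \<open>R\<close>.
\<close>

definition free_over :: "('n, 'k) pring set \<Rightarrow> 'm set \<Rightarrow> bool" where
  "free_over R N \<longleftrightarrow> (\<exists>B\<subseteq>N. \<forall>x\<in>N. \<exists>!c. range c \<subseteq> R \<and> finite {v. c v \<noteq> 0} \<and> {v. c v \<noteq> 0} \<subseteq> B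
      \<and> x = (\<Sum>v | c v \<noteq> 0. scale (c v) v))"

text \<open>
  The zero module is free of rank 0 over every \<open>K[Z]\<close>; requiring \<open>u \<noteq> 0\<close> excludes it, since it does not
  have dimension \<open>|Z|\<close>. (Dropping zero summands from a decomposition cannot lower its Stanley depth.)
\<close>

definition stanley_space :: "'m \<Rightarrow> 'n set \<Rightarrow> bool" where
  "stanley_space u Z \<longleftrightarrow> homogeneous u \<and> u \<noteq> 0 \<and> free_over (poly_subring Z) (stanley_span u Z)"

text \<open>
  A decomposition is the list of the pairs \<open>(u\<^sub>i, Z\<^sub>i)\<close>; the sum is direct and equal to \<open>M\<close> iff summation
  is a bijection from the product of the summands onto \<open>M\<close>. It is compatible with the grading because
  the \<open>u\<^sub>i\<close> are homogeneous.
\<close>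

definition stanley_decomposition :: "('m \<times> 'n set) list \<Rightarrow> bool" where
  "stanley_decomposition D \<longleftrightarrow>
    (\<forall>(u, Z) \<in> set D. stanley_space u Z) \<and>
    bij_betw (\<lambda>y. \<Sum>i<length D. y i)
      (\<Pi>\<^sub>E i\<in>{..<length D}. stanley_span (fst (D ! i)) (snd (D ! i))) M"

definition sdepth_of :: "('m \<times> 'n set) list \<Rightarrow> nat" where
  "sdepth_of D = Min ((\<lambda>(u, Z). card Z) ` set D)"

text \<open>As \<open>M \<noteq> 0\<close>, every decomposition is nonempty and has \<open>sdepth_of D \<le> n\<close>, so the set below is finite.\<close>

definition sdepth :: nat where
  "sdepth = Max {sdepth_of D | D. stanley_decomposition D}"

end

abbreviation ideal_gen :: "('n, 'k::field) pring set \<Rightarrow> ('n, 'k) pring set" where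
  "ideal_gen G \<equiv> module.span (*) G"

definition monomial_ideal :: "('n, 'k::field) pring set \<Rightarrow> bool" where
  "monomial_ideal I \<longleftrightarrow> (\<exists>A. I = ideal_gen (xpow ` A))"

text \<open>The component \<open>I \<inter> S\<^sub>a\<close>, which is zero if \<open>a\<close> has a negative entry.\<close>

definition ideal_component :: "('n, 'k::field) pring set \<Rightarrow> ('n \<Rightarrow> int) \<Rightarrow> ('n, 'k) pring set" where
  "ideal_component I a = {f \<in> I. \<forall>b\<in>Poly_Mapping.keys f. mdeg b = a}"

abbreviation sdepth_ideal :: "('n::finite, 'k::field) pring set \<Rightarrow> nat" where
  "sdepth_ideal I \<equiv> multigraded_module.sdepth (*) (ideal_component I) I"

lemma module_pring: "module ((*) :: ('n, 'k::field) pring \<Rightarrow> _)"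
  by unfold_locales (simp_all add: algebra_simps)

lemma module_pring_const: "module (\<lambda>c. (*) (const c :: ('n, 'k::field) pring))"
  by unfold_locales
    (simp_all add: algebra_simps const_def single_add mult_single flip: mult.assoc)

lemma mdeg_add: "mdeg (b + b') = (\<lambda>i. mdeg b' i + mdeg b i)"
  by (simp add: mdeg_def lookup_add fun_eq_iff)

lemma monomial_ideal_term:
  fixes I :: "('n, 'k::field) pring set"
  assumes "monomial_ideal I" and "f \<in> I"
  shows "Poly_Mapping.single b (Poly_Mapping.lookup f b) \<in> I"
proof -
  interpret S: module "(*) :: ('n, 'k) pring \<Rightarrow> _" by (rule module_pring)
  obtain A where I: "I = ideal_gen (xpow ` A)" using assms(1) by (auto simp: monomial_ideal_def)
  have "f \<in> S.span (xpow ` A)" using assms(2) I by simp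
  then show ?thesis unfolding I
  proof (induction rule: S.span_induct_alt)
    case base
    then show ?case by (simp add: S.span_zero)
  next
    case (step p x y)
    then obtain a where a: "x = xpow a" "a \<in> A" by auto
    have "Poly_Mapping.single b (Poly_Mapping.lookup (p * x) b) \<in> S.span (xpow ` A)"
    proof (cases "\<exists>b'. b = b' + a")
      case True
      then obtain b' where "b = b' + a" by blast
      then have "Poly_Mapping.single b (Poly_Mapping.lookup (p * x) b) =
          Poly_Mapping.single b' (Poly_Mapping.lookup (p * x) b) * xpow a"
        by (simp add: xpow_def mult_single)
      then show ?thesis using a by (auto intro: S.span_scale S.span_base)
    next
      case False
      have "Poly_Mapping.keys (p * x) \<subseteq> {c + a | c. True}"
        using keys_mult[of p x] a by (auto simp: xpow_def)
      then have "Poly_Mapping.lookup (p * x) b = 0" using False by (auto simp: in_keys_iff)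
      then show ?thesis by (simp add: S.span_zero)
    qed
    then show ?case using step by (simp add: lookup_add single_add S.span_add)
  qed
qed

lemma multigraded_module_ideal:
  fixes I :: "('n::finite, 'k::field) pring set"
  assumes mon: "monomial_ideal I" and "I \<noteq> {0}" and "finite G" and gen: "I = ideal_gen G"
  shows "multigraded_module (*) (ideal_component I) I"
proof -
  interpret S: module "(*) :: ('n, 'k) pring \<Rightarrow> _" by (rule module_pring)
  interpret K: module "\<lambda>c. (*) (const c :: ('n, 'k) pring)" by (rule module_pring_const)
  have sub: "S.subspace I" using gen by simp
  show ?thesis
  proof
    show "S.subspace I" by (rule sub)
    show "I \<noteq> {0}" by fact
    show "\<exists>G. finite G \<and> I = S.span G" using assms by blast
    show "ideal_component I a \<subseteq> I" for a by (auto simp: ideal_component_def)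
    show "K.subspace (ideal_component I a)" for a
    proof (rule K.subspaceI)
      show "0 \<in> ideal_component I a" by (simp add: ideal_component_def S.subspace_0[OF sub])
    next
      fix x y assume "x \<in> ideal_component I a" "y \<in> ideal_component I a"
      then show "x + y \<in> ideal_component I a"
        using keys_add[of x y] by (auto simp: ideal_component_def S.subspace_add[OF sub])
    next
      fix c x assume "x \<in> ideal_component I a"
      then show "const c * x \<in> ideal_component I a"
        using keys_mult[of "const c" x]
        by (auto simp: ideal_component_def S.subspace_scale[OF sub] const_def split: if_splits)
    qed
    show "xpow b * x \<in> ideal_component I (\<lambda>i. a i + mdeg b i)" if "x \<in> ideal_component I a" for x a b
      using that keys_mult[of "xpow b" x]
      by (auto simp: ideal_component_def S.subspace_scale[OF sub] xpow_def mdeg_add)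
  next
    fix x assume x: "x \<in> I"
    define g where "g a = (\<Sum>b | b \<in> Poly_Mapping.keys x \<and> mdeg b = a.
        Poly_Mapping.single b (Poly_Mapping.lookup x b))" for a
    have g: "Poly_Mapping.lookup (g a) b = (if mdeg b = a then Poly_Mapping.lookup x b else 0)" for a b
    proof -
      have "{b \<in> Poly_Mapping.keys x. mdeg b = a} = Poly_Mapping.keys x \<inter> {b. mdeg b = a}" by blast
      then show ?thesis
        by (auto simp: g_def lookup_sum lookup_single when_def in_keys_iff sum.If_cases)
    qed
    have supp: "{a. g a \<noteq> 0} \<subseteq> mdeg ` Poly_Mapping.keys x"
    proof
      fix a assume "a \<in> {a. g a \<noteq> 0}"
      then obtain b where "Poly_Mapping.lookup (g a) b \<noteq> 0" by (metis mem_Collect_eq poly_mapping_eqI lookup_zero)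
      then show "a \<in> mdeg ` Poly_Mapping.keys x" by (auto simp: g in_keys_iff split: if_splits)
    qed
    have fin: "finite {a. g a \<noteq> 0}" using supp by (rule finite_subset) simp
    have comp: "g a \<in> ideal_component I a" for a
    proof -
      have "g a \<in> I" unfolding g_def
        by (rule S.subspace_sum[OF sub]) (rule monomial_ideal_term[OF mon x])
      then show ?thesis by (auto simp: ideal_component_def in_keys_iff g split: if_splits)
    qed
    have sum_lookup: "Poly_Mapping.lookup (\<Sum>a | h a \<noteq> 0. h a) b = Poly_Mapping.lookup (h (mdeg b)) b"
      if "finite {a. h a \<noteq> 0}" "\<forall>a. h a \<in> ideal_component I a" for h b
    proof -
      have "Poly_Mapping.lookup (h a) b = 0" if "a \<noteq> mdeg b" for a
        using \<open>\<forall>a. h a \<in> ideal_component I a\<close> that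
        by (auto simp: ideal_component_def in_keys_iff)
      then have "Poly_Mapping.lookup (\<Sum>a | h a \<noteq> 0. h a) b =
          (\<Sum>a | h a \<noteq> 0. if a = mdeg b then Poly_Mapping.lookup (h a) b else 0)"
        unfolding lookup_sum by (intro sum.cong) auto
      then show ?thesis using that(1) by (auto simp: sum.delta)
    qed
    show "\<exists>!h. finite {a. h a \<noteq> 0} \<and> (\<forall>a. h a \<in> ideal_component I a) \<and> x = (\<Sum>a | h a \<noteq> 0. h a)"
    proof (rule ex1I[of _ g])
      show "finite {a. g a \<noteq> 0} \<and> (\<forall>a. g a \<in> ideal_component I a) \<and> x = (\<Sum>a | g a \<noteq> 0. g a)"
        using fin comp sum_lookup[of g] by (auto intro!: poly_mapping_eqI simp: g)
    next
      fix h assume h: "finite {a. h a \<noteq> 0} \<and> (\<forall>a. h a \<in> ideal_component I a) \<and> x = (\<Sum>a | h a \<noteq> 0. h a)"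
      have "Poly_Mapping.lookup (h a) b = Poly_Mapping.lookup (g a) b" for a b
      proof (cases "mdeg b = a")
        case True
        then show ?thesis using h sum_lookup[of h b] by (auto simp: g)
      next
        case False
        then show ?thesis using h by (auto simp: g ideal_component_def in_keys_iff)
      qed
      then show "h = g" by (intro ext poly_mapping_eqI)
    qed
  qed
qed

end

theory Submission
  imports Defs
begin

text \<open>
  Cut \<open>I\<close> into the layers \<open>I\<^sub>k x\<^sub>n\<^sup>k\<close>. If \<open>q\<close> is the largest exponent of \<open>x\<^sub>n\<close> in a monomial generator, then
  the layers from \<open>q\<close> on are all equal and form \<open>I\<^sub>q x\<^sub>n\<^sup>q K[x\<^sub>n]\<close>, where \<open>x\<^sub>n\<close> is gained as a free
  variable, whereas \<open>I\<^sub>k\<close> for \<open>k < q\<close> needs at least one generator fewer. Hence induction on the number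
  of variables gives a Stanley decomposition (the Janet decomposition) in which every summand has
  dimension at least \<open>n - m + 1\<close> and at least 1.

  The given generators are arbitrary polynomials. By Nakayama's argument, their coefficients at the minimal
  monomials of \<open>I\<close> span the space of all such coefficient vectors, so \<open>I\<close> has at most \<open>m\<close> minimal
  monomial generators.
\<close>

subsection \<open>Partition of a monomial ideal into cones\<close>

text \<open>For \<open>p = (u, Z)\<close>, these are the exponents of the monomials in the Stanley
  space generated by the monomial with exponent \<open>u\<close> over \<open>K[Z]\<close>.\<close>

definition cone :: "('n \<Rightarrow> nat) \<times> 'n set \<Rightarrow> ('n \<Rightarrow> nat) set" where
  "cone p = {b. (\<forall>i\<in>snd p. fst p i \<le> b i) \<and> (\<forall>i. i \<notin> snd p \<longrightarrow> b i = fst p i)}"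

text \<open>Uniqueness is over pairs, so different pairs have disjoint cones. The empty family is
  allowed; it serves the layers that contain no monomial of the ideal.\<close>

definition cone_partition :: "(('n \<Rightarrow> nat) \<times> 'n set) set \<Rightarrow> ('n \<Rightarrow> nat) set \<Rightarrow> bool" where
  "cone_partition D U \<longleftrightarrow> finite D \<and> (\<forall>p\<in>D. cone p \<subseteq> U) \<and> (\<forall>b\<in>U. \<exists>!p. p \<in> D \<and> b \<in> cone p)"

text \<open>To induct on the number of variables without changing the exponent vectors, the coordinates outside
  \<open>V\<close> are frozen at those of \<open>w\<close> and ignored in the generators \<open>A\<close>.\<close>

definition slice :: "'n set \<Rightarrow> ('n \<Rightarrow> nat) \<Rightarrow> ('n \<Rightarrow> nat) set \<Rightarrow> ('n \<Rightarrow> nat) set" where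
  "slice V w A = {b. (\<forall>i. i \<notin> V \<longrightarrow> b i = w i) \<and> (\<exists>a\<in>A. \<forall>i\<in>V. a i \<le> b i)}"

lemma apex_in_cone: "fst p \<in> cone p"
  by (simp add: cone_def)

text \<open>Sweeping a cone of the layer \<open>q\<close> along \<open>x\<close>: resetting the
  \<open>x\<close>-coordinate to \<open>q\<close> projects the larger cone onto the smaller.\<close>

lemma cone_insert_iff:
  assumes "x \<notin> Z" and "u x = q"
  shows "b \<in> cone (u, insert x Z) \<longleftrightarrow> q \<le> b x \<and> b(x := q) \<in> cone (u, Z)"
  using assms by (auto simp: cone_def)

lemma slice_upd_iff:
  assumes "x \<notin> V"
  shows "b \<in> slice V (w(x := k)) A \<longleftrightarrow>
    b x = k \<and> (\<forall>i. i \<notin> insert x V \<longrightarrow> b i = w i) \<and> (\<exists>a\<in>A. \<forall>i\<in>V. a i \<le> b i)"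
  using assms unfolding slice_def by auto

text \<open>A generator with \<open>x\<close>-exponent above \<open>k\<close> divides no monomial of
  the layer, so the layer is a slice in fewer variables over the remaining generators.\<close>

lemma slice_layer:
  assumes "x \<notin> V"
  shows "slice V (w(x := k)) {a \<in> A. a x \<le> k} = {b \<in> slice (insert x V) w A. b x = k}"
  using assms by (auto simp: slice_upd_iff) (auto simp: slice_def)

text \<open>From \<open>q\<close> on, no generator imposes a condition in the direction
  \<open>x\<close>.\<close>

lemma slice_top:
  assumes "x \<notin> V" and "\<forall>a\<in>A. a x \<le> q" and "q \<le> b x"
  shows "b \<in> slice (insert x V) w A \<longleftrightarrow> b(x := q) \<in> slice V (w(x := q)) A"
proof -
  have "(\<forall>i\<in>insert x V. a i \<le> b i) \<longleftrightarrow> (\<forall>i\<in>V. a i \<le> (b(x := q)) i)" if "a \<in> A" for a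
    using assms that by (metis fun_upd_apply insert_iff order_trans)
  then show ?thesis using assms(1) by (auto simp: slice_def)
qed

text \<open>Cut along the last variable \<open>x\<close> at the largest exponent \<open>q\<close> of a generator. Each of the \<open>q\<close> layers
  below loses the variable \<open>x\<close> and also at least one generator; the part above is the layer at \<open>q\<close>
  times all powers of \<open>x\<close>.\<close>

lemma slice_cone_partition:
  assumes "finite V" "V \<noteq> {}" and "finite A" "A \<noteq> {}"
  shows "\<exists>D. cone_partition D (slice V w A) \<and>
    (\<forall>p\<in>D. snd p \<subseteq> V \<and> 1 \<le> card (snd p) \<and> card V + 1 \<le> card (snd p) + card A)"
  using assms
proof (induction V arbitrary: w A rule: finite_ne_induct)
  case (singleton x)
  \<comment> \<open>In one variable the ideal is principal, so one cone of dimension 1 suffices.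
    Starting at no variables would violate \<open>1 \<le> card (snd p)\<close>.\<close>
  define q where "q = Min ((\<lambda>a. a x) ` A)"
  have "q \<in> (\<lambda>a. a x) ` A" and le: "\<And>a. a \<in> A \<Longrightarrow> q \<le> a x"
    using singleton by (auto simp: q_def intro: Min_in)
  then have "(\<exists>a\<in>A. a x \<le> k) \<longleftrightarrow> q \<le> k" for k by (auto intro: order_trans)
  then have "slice {x} w A = cone (w(x := q), {x})"
    by (auto simp: slice_def cone_def)
  then have "cone_partition {(w(x := q), {x})} (slice {x} w A)"
    by (auto simp: cone_partition_def)
  then show ?case using singleton
    by (intro exI[of _ "{(w(x := q), {x})}"]) (auto simp: Suc_le_eq card_gt_0_iff)
next
  case (insert x V)
  define q where "q = Max ((\<lambda>a. a x) ` A)"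
  have "q \<in> (\<lambda>a. a x) ` A" and le: "\<forall>a\<in>A. a x \<le> q"
    using insert.prems by (auto simp: q_def intro: Max_in)
  then obtain a0 where a0: "a0 \<in> A" "a0 x = q" by blast
  let ?P = "\<lambda>k m D. cone_partition D {b \<in> slice (insert x V) w A. b x = k} \<and>
    (\<forall>p\<in>D. snd p \<subseteq> V \<and> 1 \<le> card (snd p) \<and> card V + 1 \<le> card (snd p) + m)"
  have low: "\<exists>D. ?P k (card A - 1) D" if "k < q" for k
  proof (cases "{a \<in> A. a x \<le> k} = {}")
    \<comment> \<open>The induction hypothesis wants a generator; a layer below all of them is
      empty.\<close>
    case True
    then have "{b \<in> slice (insert x V) w A. b x = k} = {}"
      by (auto simp: slice_def)
    then show ?thesis unfolding cone_partition_def by (intro exI[of _ "{}"]) blast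
  next
    case False
    \<comment> \<open>The generator \<open>a0\<close> of largest \<open>x\<close>-exponent is absent
      from the layer. This spared generator pays for the lost variable.\<close>
    have "card {a \<in> A. a x \<le> k} \<le> card (A - {a0})"
      using that a0 insert.prems by (intro card_mono) auto
    then have "card {a \<in> A. a x \<le> k} \<le> card A - 1" using a0 insert.prems by simp
    moreover obtain D where "cone_partition D {b \<in> slice (insert x V) w A. b x = k}"
      "\<forall>p\<in>D. snd p \<subseteq> V \<and> 1 \<le> card (snd p) \<and>
        card V + 1 \<le> card (snd p) + card {a \<in> A. a x \<le> k}"
      using insert.IH[of "{a \<in> A. a x \<le> k}" "w(x := k)"] insert.prems False
      unfolding slice_layer[OF insert.hyps(3)] by auto
    ultimately show ?thesis by (intro exI[of _ D]) fastforce
  qed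
  have top: "\<exists>D. ?P q (card A) D"
  proof -
    have "{a \<in> A. a x \<le> q} = A" using le by blast
    then have "slice V (w(x := q)) A = {b \<in> slice (insert x V) w A. b x = q}"
      using slice_layer[OF insert.hyps(3), of w q A] by simp
    then show ?thesis using insert.IH[OF insert.prems, of "w(x := q)"] by metis
  qed
  have "\<exists>D. ?P k (if k < q then card A - 1 else card A) D" if "k \<in> {..q}" for k
    using low[of k] top that by (cases "k = q") auto
  then have "\<forall>k\<in>{..q}. \<exists>D. ?P k (if k < q then card A - 1 else card A) D" by blast
  from bchoice[OF this] obtain D
    where D: "\<forall>k\<in>{..q}. ?P k (if k < q then card A - 1 else card A) (D k)" by blast
  have lowD: "?P k (card A - 1) (D k)" if "k < q" for k
    using bspec[OF D, of k] that by simp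
  have topD: "?P q (card A) (D q)" using bspec[OF D, of q] by simp
  \<comment> \<open>Cones below \<open>q\<close> stay as they are. Those of the layer
    \<open>q\<close> are swept out along \<open>x\<close>, which raises their dimension by
    one.\<close>
  define E where "E = (\<Union>k<q. D k) \<union> (\<lambda>p. (fst p, insert x (snd p))) ` D q"
  have sub: "snd p \<subseteq> V" "cone p \<subseteq> {b \<in> slice (insert x V) w A. b x = k}"
    if "k \<le> q" "p \<in> D k" for k p
    using bspec[OF D, of k] that unfolding cone_partition_def by blast+
  \<comment> \<open>A cone contains its apex, so lying in the layer \<open>k\<close> fixes the
    \<open>x\<close>-coordinate of the apex.\<close>
  have apex: "fst p x = k" "x \<notin> snd p" if "k \<le> q" "p \<in> D k" for k p
    using sub[OF that] apex_in_cone[of p] insert.hyps by auto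
  have topcone: "b \<in> cone (fst p, insert x (snd p)) \<longleftrightarrow> q \<le> b x \<and> b(x := q) \<in> cone p"
    if "p \<in> D q" for p b
    using cone_insert_iff[of x "snd p" "fst p" q b] apex[OF _ that] by simp
  have ex1: "\<exists>!p. p \<in> E \<and> b \<in> cone p" if b: "b \<in> slice (insert x V) w A" for b
  proof (cases "b x < q")
    case True
    have "\<exists>!p. p \<in> D (b x) \<and> b \<in> cone p"
      using lowD[OF True] b by (simp add: cone_partition_def)
    moreover have "p \<in> E \<and> b \<in> cone p \<longleftrightarrow> p \<in> D (b x) \<and> b \<in> cone p" for p
    proof
      assume p: "p \<in> E \<and> b \<in> cone p"
      have "p \<notin> (\<lambda>p. (fst p, insert x (snd p))) ` D q" using p topcone True by auto
      then obtain k where "k < q" "p \<in> D k" using p by (auto simp: E_def)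
      then show "p \<in> D (b x) \<and> b \<in> cone p" using sub(2)[of k p] p by auto
    qed (use True in \<open>auto simp: E_def\<close>)
    ultimately show ?thesis by simp
  next
    case False
    \<comment> \<open>The two instances of \<open>slice_top\<close> have the same right-hand side,
      so \<open>b\<close> and \<open>b(x := q)\<close> belong to the slice together.\<close>
    then have "b(x := q) \<in> {b \<in> slice (insert x V) w A. b x = q}"
      using slice_top[OF insert.hyps(3) le, of b w] slice_top[OF insert.hyps(3) le, of "b(x := q)" w] b
      by simp
    then have "\<exists>!p. p \<in> D q \<and> b(x := q) \<in> cone p" using topD by (simp add: cone_partition_def)
    then obtain p where p: "p \<in> D q" "b(x := q) \<in> cone p"
      and uniq: "\<And>p'. p' \<in> D q \<Longrightarrow> b(x := q) \<in> cone p' \<Longrightarrow> p' = p" by blast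
    show ?thesis
    proof (rule ex1I[of _ "(fst p, insert x (snd p))"])
      show "(fst p, insert x (snd p)) \<in> E \<and> b \<in> cone (fst p, insert x (snd p))"
        using p False topcone by (auto simp: E_def)
    next
      fix r assume r: "r \<in> E \<and> b \<in> cone r"
      have "r \<notin> D k" if "k < q" for k using sub(2)[of k r] that r False by auto
      then obtain p' where "p' \<in> D q" "r = (fst p', insert x (snd p'))"
        using r by (auto simp: E_def)
      then show "r = (fst p, insert x (snd p))" using uniq topcone r by blast
    qed
  qed
  have "cone r \<subseteq> slice (insert x V) w A" if r: "r \<in> E" for r
  proof (cases "\<exists>k<q. r \<in> D k")
    case True
    then obtain k where "k < q" "r \<in> D k" by blast
    then show ?thesis using sub(2)[of k r] by auto
  next
    case False
    then obtain p where p: "p \<in> D q" "r = (fst p, insert x (snd p))"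
      using r by (auto simp: E_def)
    show ?thesis
    proof
      fix b assume b: "b \<in> cone r"
      then have "b(x := q) \<in> slice (insert x V) w A" "q \<le> b x"
        using p topcone sub(2)[of q p] by auto
      then show "b \<in> slice (insert x V) w A"
        using slice_top[OF insert.hyps(3) le, of b w]
          slice_top[OF insert.hyps(3) le, of "b(x := q)" w] by simp
    qed
  qed
  moreover have "finite E" using lowD topD by (auto simp: E_def cone_partition_def)
  ultimately have "cone_partition E (slice (insert x V) w A)" using ex1 by (simp add: cone_partition_def)
  moreover have "\<forall>r\<in>E. snd r \<subseteq> insert x V \<and> 1 \<le> card (snd r) \<and>
    card (insert x V) + 1 \<le> card (snd r) + card A"
  proof
    fix r assume "r \<in> E"
    then consider k where "k < q" "r \<in> D k" | p where "p \<in> D q" "r = (fst p, insert x (snd p))"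
      by (auto simp: E_def)
    then show "snd r \<subseteq> insert x V \<and> 1 \<le> card (snd r) \<and> card (insert x V) + 1 \<le> card (snd r) + card A"
    proof cases
      case 1
      \<comment> \<open>Guards the truncated subtraction in \<open>card A - 1\<close>.\<close>
      have "0 < card A" using insert.prems by (simp add: card_gt_0_iff)
      moreover have "snd r \<subseteq> V \<and> 1 \<le> card (snd r) \<and> card V + 1 \<le> card (snd r) + (card A - 1)"
        using lowD[OF 1(1)] 1(2) by blast
      ultimately show ?thesis using insert.hyps by auto
    next
      case 2
      have p: "snd p \<subseteq> V \<and> 1 \<le> card (snd p) \<and> card V + 1 \<le> card (snd p) + card A"
        using topD 2(1) by blast
      moreover have "finite (snd p)" using p insert.hyps finite_subset by blast
      ultimately show ?thesis using apex(2)[OF _ 2(1)] insert.hyps 2(2) by auto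
    qed
  qed
  ultimately show ?case by blast
qed

subsection \<open>Minimal monomials\<close>

lemma poly_mapping_sum_single: "p = (\<Sum>b\<in>Poly_Mapping.keys p. Poly_Mapping.single b (Poly_Mapping.lookup p b))"
  by (rule poly_mapping_eqI) (simp add: lookup_sum lookup_single when_def in_keys_iff)

lemma lookup_const_mult: "Poly_Mapping.lookup (const c * f) b = c * Poly_Mapping.lookup f b"
proof -
  have "const c * f = (\<Sum>b\<in>Poly_Mapping.keys f. Poly_Mapping.single b (c * Poly_Mapping.lookup f b))"
    by (subst poly_mapping_sum_single[of f]) (simp add: const_def sum_distrib_left mult_single)
  then show ?thesis by (simp add: lookup_sum lookup_single when_def in_keys_iff)
qed

lemma lookup_mult_xpow: "Poly_Mapping.lookup (p * xpow u) (b + u) = Poly_Mapping.lookup p b"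
proof -
  have "p * xpow u = (\<Sum>b\<in>Poly_Mapping.keys p. Poly_Mapping.single (b + u) (Poly_Mapping.lookup p b))"
    by (subst poly_mapping_sum_single[of p]) (simp add: xpow_def sum_distrib_right mult_single)
  then show ?thesis by (simp add: lookup_sum lookup_single when_def in_keys_iff)
qed

lemma xpow_neq_0: "xpow b \<noteq> 0"
  by (auto simp: xpow_def dest: arg_cong[of _ _ Poly_Mapping.keys])

lemma inj_xpow: "inj xpow"
  by (auto simp: inj_def xpow_def dest: arg_cong[of _ _ Poly_Mapping.keys])

lemma mult_xpow_cancel: "p * xpow u = q * xpow u \<Longrightarrow> p = q"
  by (metis lookup_mult_xpow poly_mapping_eqI)

text \<open>Used with two kinds of \<open>C\<close>: for the minimal exponents of \<open>I\<close>
  it represents the class of \<open>f\<close> modulo the irrelevant ideal times \<open>I\<close>;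
  for a cone it gives the component of \<open>f\<close> in a Stanley space.\<close>

definition trunc :: "('n \<Rightarrow>\<^sub>0 nat) set \<Rightarrow> ('n, 'k::field) pring \<Rightarrow> ('n, 'k) pring" where
  "trunc C f = (\<Sum>b\<in>Poly_Mapping.keys f \<inter> C. Poly_Mapping.single b (Poly_Mapping.lookup f b))"

lemma lookup_trunc: "Poly_Mapping.lookup (trunc C f) b = (if b \<in> C then Poly_Mapping.lookup f b else 0)"
  by (auto simp: trunc_def lookup_sum lookup_single when_def in_keys_iff)

lemma keys_trunc: "Poly_Mapping.keys (trunc C f) = Poly_Mapping.keys f \<inter> C"
  by (auto simp: in_keys_iff lookup_trunc split: if_splits)

text \<open>Divisibility is written with the exponent \<open>c\<close> of the cofactor. If
  \<open>E\<close> is the exponent set of a monomial ideal, these are its minimal monomial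
  generators.\<close>

definition min_exps :: "('n \<Rightarrow>\<^sub>0 nat) set \<Rightarrow> ('n \<Rightarrow>\<^sub>0 nat) set" where
  "min_exps E = {a \<in> E. \<forall>b c. a = c + b \<longrightarrow> b \<in> E \<longrightarrow> c = 0}"

text \<open>Descent on the total degree, which drops on passing to a proper divisor.\<close>

lemma min_exps_below:
  fixes e :: "'n::finite \<Rightarrow>\<^sub>0 nat"
  assumes "e \<in> E"
  shows "\<exists>a\<in>min_exps E. \<exists>c. e = c + a"
  using assms
proof (induction "\<Sum>i\<in>UNIV. Poly_Mapping.lookup e i" arbitrary: e rule: less_induct)
  case less
  show ?case
  proof (cases "e \<in> min_exps E")
    case True
    then show ?thesis by (intro bexI[of _ e] exI[of _ 0]) auto
  next
    case False
    then obtain b c where bc: "e = c + b" "b \<in> E" "c \<noteq> 0" using less.prems by (auto simp: min_exps_def)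
    then obtain i where "Poly_Mapping.lookup c i \<noteq> 0" by (metis poly_mapping_eqI lookup_zero)
    then have "(\<Sum>i\<in>UNIV. Poly_Mapping.lookup b i) < (\<Sum>i\<in>UNIV. Poly_Mapping.lookup e i)"
      by (intro sum_strict_mono_ex1) (auto simp: bc lookup_add)
    then obtain a c' where "a \<in> min_exps E" "b = c' + a" using less.hyps bc by blast
    then show ?thesis using bc by (metis add.assoc)
  qed
qed

section \<open>Monomial ideals and the number of their minimal generators\<close>

lemma ideal_mult:
  fixes I :: "('n, 'k::field) pring set"
  assumes "I = ideal_gen G" and "f \<in> I"
  shows "p * f \<in> I"
proof -
  interpret S: module "(*) :: ('n, 'k) pring \<Rightarrow> _" by (rule module_pring)
  show ?thesis using assms by (simp add: S.span_scale)
qed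

text \<open>Every term of \<open>f\<close> lies in \<open>I\<close> and its coefficient is a unit.
  Thus \<open>I\<close> is determined by its set of exponents.\<close>

lemma monomial_ideal_mem_iff:
  fixes I :: "('n, 'k::field) pring set"
  assumes "monomial_ideal I"
  shows "f \<in> I \<longleftrightarrow> (\<forall>b\<in>Poly_Mapping.keys f. xpow b \<in> I)"
proof -
  interpret S: module "(*) :: ('n, 'k) pring \<Rightarrow> _" by (rule module_pring)
  obtain A where I: "I = ideal_gen (xpow ` A)" using assms by (auto simp: monomial_ideal_def)
  have single: "Poly_Mapping.single b c = const c * xpow b" for b c
    by (simp add: const_def xpow_def mult_single)
  show ?thesis
  proof
    assume f: "f \<in> I"
    show "\<forall>b\<in>Poly_Mapping.keys f. xpow b \<in> I"
    proof
      fix b assume b: "b \<in> Poly_Mapping.keys f"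
      let ?c = "Poly_Mapping.lookup f b"
      have "const (inverse ?c) * Poly_Mapping.single b ?c = xpow b"
        using b by (simp add: const_def xpow_def mult_single in_keys_iff)
      then show "xpow b \<in> I" using ideal_mult[OF I monomial_ideal_term[OF assms f]] by metis
    qed
  next
    assume r: "\<forall>b\<in>Poly_Mapping.keys f. xpow b \<in> I"
    have "(\<Sum>b\<in>Poly_Mapping.keys f. Poly_Mapping.single b (Poly_Mapping.lookup f b)) \<in> I"
      unfolding single using r ideal_mult[OF I] by (auto simp: I intro!: S.span_sum)
    then show "f \<in> I" using poly_mapping_sum_single[of f] by simp
  qed
qed

text \<open>Modulo the irrelevant ideal times \<open>I\<close>, a polynomial multiple is a scalar multiple.\<close>

lemma lookup_mult_min_exps:
  fixes I :: "('n, 'k::field) pring set"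
  assumes I: "monomial_ideal I" and g: "g \<in> I" and a: "a \<in> min_exps {b. xpow b \<in> I}"
  shows "Poly_Mapping.lookup (p * g) a = Poly_Mapping.lookup p 0 * Poly_Mapping.lookup g a"
proof -
  have "Poly_Mapping.lookup (Poly_Mapping.single b c * g) a =
      (if b = 0 then c * Poly_Mapping.lookup g a else 0)" for b c
  proof (cases "b = 0")
    case True
    then show ?thesis using lookup_const_mult[of c g a] by (simp add: const_def)
  next
    case False
    \<comment> \<open>\<open>xpow k\<close> is itself in \<open>I\<close>, so
      \<open>a = b + k\<close> with \<open>b \<noteq> 0\<close> would contradict minimality.\<close>
    have "a \<noteq> b + k" if "k \<in> Poly_Mapping.keys g" for k
      using a False that g monomial_ideal_mem_iff[OF I, of g] by (auto simp: min_exps_def)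
    then have "a \<notin> Poly_Mapping.keys (Poly_Mapping.single b c * g)"
      using keys_mult[of "Poly_Mapping.single b c" g] by (auto split: if_splits)
    then show ?thesis using False by (simp add: in_keys_iff)
  qed
  then have "Poly_Mapping.lookup ((\<Sum>b\<in>Poly_Mapping.keys p. Poly_Mapping.single b (Poly_Mapping.lookup p b)) * g) a
      = Poly_Mapping.lookup p 0 * Poly_Mapping.lookup g a"
    by (simp add: sum_distrib_right lookup_sum sum.delta in_keys_iff)
  then show ?thesis using poly_mapping_sum_single[of p] by simp
qed

lemma card_min_exps_le:
  fixes I :: "('n, 'k::field) pring set"
  assumes I: "monomial_ideal I" and G: "finite G" and gen: "I = ideal_gen G"
  shows "finite (min_exps {b. xpow b \<in> I}) \<and> card (min_exps {b. xpow b \<in> I}) \<le> card G"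
proof -
  let ?A = "min_exps {b. xpow b \<in> I}"
  interpret S: module "(*) :: ('n, 'k) pring \<Rightarrow> _" by (rule module_pring)
  interpret K: vector_space "\<lambda>c. (*) (const c :: ('n, 'k) pring)"
    using module_pring_const unfolding module_def vector_space_def .
  \<comment> \<open>Truncation turns an \<open>S\<close>-combination of \<open>G\<close> into a
    \<open>K\<close>-combination of the truncated generators, whose coefficients are the constant
    terms.\<close>
  have span: "trunc ?A f \<in> K.span (trunc ?A ` G)" if "f \<in> S.span G" for f
    using that
  proof (induction rule: S.span_induct_alt)
    case base
    have "trunc ?A 0 = 0" by (simp add: trunc_def)
    then show ?case using K.span_zero by metis
  next
    case (step p g f)
    have "g \<in> I" using step gen by (simp add: S.span_base)
    then have "trunc ?A (p * g + f) = const (Poly_Mapping.lookup p 0) * trunc ?A g + trunc ?A f"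
      by (intro poly_mapping_eqI)
        (simp add: lookup_trunc lookup_add lookup_const_mult lookup_mult_min_exps[OF I])
    then show ?case using step by (simp add: K.span_add K.span_scale K.span_base)
  qed
  have "trunc ?A (xpow a) = xpow a" if "a \<in> ?A" for a
    using that by (intro poly_mapping_eqI) (auto simp: lookup_trunc xpow_def lookup_single when_def)
  moreover have "xpow a \<in> I" if "a \<in> ?A" for a using that by (simp add: min_exps_def)
  ultimately have "xpow ` ?A \<subseteq> K.span (trunc ?A ` G)"
    using span gen by (metis (no_types, lifting) image_subsetI)
  moreover have "\<not> K.dependent (xpow ` ?A)"
  proof
    assume "K.dependent (xpow ` ?A)"
    then obtain a where "xpow a \<in> K.span (xpow ` ?A - {xpow a})" by (auto simp: K.dependent_def)
    \<comment> \<open>The other monomials have coefficient 0 at \<open>a\<close>, hence so does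
      their span, whereas \<open>xpow a\<close> has coefficient 1.\<close>
    moreover have "K.span (xpow ` ?A - {xpow a}) \<subseteq> {f. Poly_Mapping.lookup f a = 0}"
      by (rule K.span_minimal, force simp: xpow_def lookup_single when_def, rule K.subspaceI)
        (auto simp: lookup_add lookup_const_mult)
    ultimately show False by (auto simp: xpow_def)
  qed
  \<comment> \<open>Independent vectors in the span of a finite set: this yields the finiteness of
    \<open>?A\<close> together with the bound.\<close>
  ultimately have "finite (xpow ` ?A :: ('n, 'k) pring set) \<and> card (xpow ` ?A :: ('n, 'k) pring set) \<le> card (trunc ?A ` G)"
    using G by (intro K.independent_span_bound) auto
  moreover have "inj_on (xpow :: _ \<Rightarrow> ('n, 'k) pring) ?A" using inj_xpow inj_on_subset by blast
  ultimately show ?thesis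
    using card_image_le[OF G, of "trunc ?A"] by (auto simp: card_image dest: finite_imageD)
qed

subsection \<open>Stanley decompositions from cones\<close>

text \<open>With finitely many variables every function has finite support, so the abstraction loses
  nothing.\<close>

definition apex :: "('n::finite \<Rightarrow> nat) \<times> 'n set \<Rightarrow> 'n \<Rightarrow>\<^sub>0 nat" where
  "apex p = Abs_poly_mapping (fst p)"

lemma lookup_apex [simp]: "Poly_Mapping.lookup (apex p) = fst p"
  by (simp add: apex_def)

lemma lookup_in_cone_iff:
  "Poly_Mapping.lookup b \<in> cone p \<longleftrightarrow> (\<exists>c. Poly_Mapping.keys c \<subseteq> snd p \<and> b = c + apex p)"
proof
  assume b: "Poly_Mapping.lookup b \<in> cone p"
  \<comment> \<open>The truncated subtraction is exact, since the apex lies below \<open>b\<close>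
    in every coordinate.\<close>
  define c where "c = Abs_poly_mapping (\<lambda>i. Poly_Mapping.lookup b i - fst p i)"
  have "Poly_Mapping.keys c \<subseteq> snd p"
    using b by (auto simp: c_def in_keys_iff cone_def)
  moreover have "fst p i \<le> Poly_Mapping.lookup b i" for i
    using b by (cases "i \<in> snd p") (auto simp: cone_def)
  then have "b = c + apex p"
    by (intro poly_mapping_eqI) (simp add: lookup_add c_def)
  ultimately show "\<exists>c. Poly_Mapping.keys c \<subseteq> snd p \<and> b = c + apex p" by blast
qed (auto simp: cone_def lookup_add in_keys_iff)

text \<open>The spanning products are exactly the monomials with exponent in the cone. This
  translates direct sums of Stanley spaces into partitions of exponents.\<close>

lemma span_cone:
  "module.span (\<lambda>c. (*) (const c :: ('n::finite, 'k::field) pring))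
      {xpow b * xpow (apex p) | b. Poly_Mapping.keys b \<subseteq> snd p} =
    {f. \<forall>b\<in>Poly_Mapping.keys f. Poly_Mapping.lookup b \<in> cone p}" (is "?L = ?R")
proof -
  interpret K: module "\<lambda>c. (*) (const c :: ('n, 'k) pring)" by (rule module_pring_const)
  have xpow_mult: "xpow b * xpow c = (xpow (b + c) :: ('n, 'k) pring)" for b c
    by (simp add: xpow_def mult_single)
  have "K.subspace ?R"
  proof (rule K.subspaceI)
    show "x + y \<in> ?R" if "x \<in> ?R" "y \<in> ?R" for x y
      using that keys_add[of x y] by auto
    show "const c * x \<in> ?R" if "x \<in> ?R" for c x
      using that by (auto simp: in_keys_iff lookup_const_mult)
  qed simp
  then have "?L \<subseteq> ?R"
    by (intro K.span_minimal) (auto simp: xpow_mult lookup_in_cone_iff, auto simp: xpow_def)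
  moreover have "f \<in> ?L" if f: "f \<in> ?R" for f
  proof -
    have "Poly_Mapping.single b (Poly_Mapping.lookup f b) \<in> ?L" if b: "b \<in> Poly_Mapping.keys f" for b
    proof -
      obtain c where c: "Poly_Mapping.keys c \<subseteq> snd p" "b = c + apex p"
        using f b lookup_in_cone_iff by blast
      have "const (Poly_Mapping.lookup f b) * (xpow c * xpow (apex p)) \<in> ?L"
        using c by (intro K.span_scale K.span_base) blast
      then show ?thesis using c by (simp add: xpow_def const_def mult_single)
    qed
    then have "(\<Sum>b\<in>Poly_Mapping.keys f. Poly_Mapping.single b (Poly_Mapping.lookup f b)) \<in> ?L"
      by (rule K.span_sum)
    then show ?thesis using poly_mapping_sum_single[of f] by simp
  qed
  ultimately show ?thesis by blast
qed

text \<open>Supplies the coefficient for freeness: the monomial multipliers are collected into one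
  element of \<open>K[Z]\<close>.\<close>

lemma span_cone_eq_mult:
  assumes "f \<in> module.span (\<lambda>c. (*) (const c :: ('n::finite, 'k::field) pring))
      {xpow b * xpow u | b. Poly_Mapping.keys b \<subseteq> Z}"
  shows "\<exists>q\<in>poly_subring Z. f = q * xpow u"
proof -
  interpret K: module "\<lambda>c. (*) (const c :: ('n, 'k) pring)" by (rule module_pring_const)
  show ?thesis using assms
  proof (induction rule: K.span_induct_alt)
    case base
    show ?case by (intro bexI[of _ 0]) (auto simp: poly_subring_def)
  next
    case (step c x y)
    then obtain b q where "x = xpow b * xpow u" "Poly_Mapping.keys b \<subseteq> Z"
      "q \<in> poly_subring Z" "y = q * xpow u" by blast
    moreover have "const c * xpow b = Poly_Mapping.single b c"
      by (simp add: const_def xpow_def mult_single)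
    ultimately have "const c * x + y = (Poly_Mapping.single b c + q) * xpow u"
      by (simp add: distrib_right flip: mult.assoc)
    moreover have "Poly_Mapping.single b c + q \<in> poly_subring Z"
      using keys_add[of "Poly_Mapping.single b c" q] \<open>Poly_Mapping.keys b \<subseteq> Z\<close> \<open>q \<in> poly_subring Z\<close>
      unfolding poly_subring_def by (fastforce split: if_splits)
    ultimately show ?case by blast
  qed
qed

context
  fixes I G :: "('n::finite, 'k::field) pring set"
  assumes I: "monomial_ideal I" and ne: "I \<noteq> {0}" and G: "finite G" and gen: "I = ideal_gen G"
begin

interpretation M: multigraded_module "(*)" "ideal_component I" I
  by (rule multigraded_module_ideal[OF I ne G gen])

lemma stanley_span_apex:
  "M.stanley_span (xpow (apex p)) (snd p) =
    {f. \<forall>b\<in>Poly_Mapping.keys f. Poly_Mapping.lookup b \<in> cone p}"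
  unfolding M.stanley_span_def by (rule span_cone)

text \<open>The single element \<open>xpow u\<close> is a basis; coefficients are unique because
  multiplication by a monomial can be cancelled.\<close>

lemma stanley_space_xpow:
  assumes "xpow u \<in> I"
  shows "M.stanley_space (xpow u) Z"
proof -
  interpret K: module "\<lambda>c. (*) (const c :: ('n, 'k) pring)" by (rule module_pring_const)
  have "M.homogeneous (xpow u)"
    using assms by (auto simp: M.homogeneous_def ideal_component_def xpow_def)
  moreover have "M.free_over (poly_subring Z) (M.stanley_span (xpow u) Z)"
    unfolding M.free_over_def
  proof (intro exI[of _ "{xpow u}"] conjI ballI)
    have "1 * xpow u \<in> M.stanley_span (xpow u) Z" unfolding M.stanley_span_def
      by (rule K.span_base) (auto intro!: exI[of _ 0] simp: xpow_def mult_single)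
    then show "{xpow u} \<subseteq> M.stanley_span (xpow u) Z" by simp
  next
    fix f assume "f \<in> M.stanley_span (xpow u) Z"
    then obtain q where q: "q \<in> poly_subring Z" "f = q * xpow u"
      using span_cone_eq_mult unfolding M.stanley_span_def by blast
    have sum: "(\<Sum>v | c v \<noteq> 0. c v * v) = c (xpow u) * xpow u" if "{v. c v \<noteq> 0} \<subseteq> {xpow u}"
      for c :: "('n, 'k) pring \<Rightarrow> ('n, 'k) pring"
    proof -
      have "(\<Sum>v | c v \<noteq> 0. c v * v) = (\<Sum>v\<in>{xpow u}. c v * v)"
        using that by (intro sum.mono_neutral_left) auto
      then show ?thesis by simp
    qed
    define c0 :: "('n, 'k) pring \<Rightarrow> ('n, 'k) pring" where "c0 = (\<lambda>v. if v = xpow u then q else 0)"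
    show "\<exists>!c. range c \<subseteq> poly_subring Z \<and> finite {v. c v \<noteq> 0} \<and> {v. c v \<noteq> 0} \<subseteq> {xpow u} \<and>
        f = (\<Sum>v | c v \<noteq> 0. c v * v)"
    proof (rule ex1I)
      have supp: "{v. c0 v \<noteq> 0} \<subseteq> {xpow u}" by (auto simp: c0_def)
      moreover have "range c0 \<subseteq> poly_subring Z"
        using q by (auto simp: c0_def poly_subring_def)
      moreover have "f = (\<Sum>v | c0 v \<noteq> 0. c0 v * v)" using sum[OF supp] q by (simp add: c0_def)
      moreover have "finite {v. c0 v \<noteq> 0}" using supp by (rule finite_subset) simp
      ultimately show "range c0 \<subseteq> poly_subring Z \<and> finite {v. c0 v \<noteq> 0} \<and>
          {v. c0 v \<noteq> 0} \<subseteq> {xpow u} \<and> f = (\<Sum>v | c0 v \<noteq> 0. c0 v * v)"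
        by blast
    next
      fix c assume c: "range c \<subseteq> poly_subring Z \<and> finite {v. c v \<noteq> 0} \<and> {v. c v \<noteq> 0} \<subseteq> {xpow u} \<and>
        f = (\<Sum>v | c v \<noteq> 0. c v * v)"
      then have "c (xpow u) = q" using sum[of c] q mult_xpow_cancel by metis
      moreover have "c v = 0" if "v \<noteq> xpow u" for v using c that by blast
      ultimately show "c = c0" by (auto simp: c0_def)
    qed
  qed
  ultimately show ?thesis by (simp add: M.stanley_space_def xpow_neq_0)
qed

text \<open>Each \<open>f\<close> in \<open>I\<close> splits uniquely into its restrictions to the
  cones. \<open>distinct L\<close> prevents a pair from contributing the same summand at two
  indices.\<close>

lemma stanley_decomposition_cones:
  assumes part: "cone_partition (set L) (Poly_Mapping.lookup ` {b. xpow b \<in> I})" and "distinct L"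
  shows "M.stanley_decomposition (map (\<lambda>p. (xpow (apex p), snd p)) L)"
proof -
  let ?C = "\<lambda>i. {b. Poly_Mapping.lookup b \<in> cone (L ! i)}"
  let ?S = "\<lambda>i. {f :: ('n, 'k) pring. Poly_Mapping.keys f \<subseteq> ?C i}"
  have mem: "Poly_Mapping.lookup b \<in> Poly_Mapping.lookup ` {b. xpow b \<in> I} \<longleftrightarrow> xpow b \<in> I" for b
    by (auto simp: lookup_inject)
  have sub: "xpow b \<in> I" if "p \<in> set L" "Poly_Mapping.lookup b \<in> cone p" for p b
    using part that mem unfolding cone_partition_def by blast
  have cover: "\<exists>i<length L. b \<in> ?C i" if b: "xpow b \<in> I" for b
  proof -
    obtain p where "p \<in> set L" "Poly_Mapping.lookup b \<in> cone p"
      using part b mem[of b] unfolding cone_partition_def by blast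
    then show ?thesis by (auto simp: in_set_conv_nth)
  qed
  have disj: "i = j" if "i < length L" "j < length L" "b \<in> ?C i" "b \<in> ?C j" for i j b
  proof -
    have "xpow b \<in> I" using sub[of "L ! i" b] that by simp
    then have "L ! i = L ! j"
      using part mem[of b] that unfolding cone_partition_def by (metis mem_Collect_eq nth_mem)
    then show ?thesis using \<open>distinct L\<close> that by (simp add: nth_eq_iff_index_eq)
  qed
  have "xpow (apex p) \<in> I" if "p \<in> set L" for p
    using sub[OF that, of "apex p"] by (simp add: apex_in_cone)
  then have spaces: "\<forall>(u, Z) \<in> set (map (\<lambda>p. (xpow (apex p), snd p)) L). M.stanley_space u Z"
    by (auto intro: stanley_space_xpow)
  have bij: "bij_betw (\<lambda>y. \<Sum>i<length L. y i) (\<Pi>\<^sub>E i\<in>{..<length L}. ?S i) I"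
  proof -
    \<comment> \<open>By disjointness only \<open>y j\<close> contributes at an exponent in the cone
      \<open>j\<close>. Both injectivity and surjectivity rest on this.\<close>
    have coeff: "Poly_Mapping.lookup (\<Sum>i<length L. y i) b = Poly_Mapping.lookup (y j) b"
      if y: "y \<in> (\<Pi>\<^sub>E i\<in>{..<length L}. ?S i)" and j: "j < length L" "b \<in> ?C j" for y j b
    proof -
      have "Poly_Mapping.lookup (y i) b = 0" if "i < length L" "i \<noteq> j" for i
        using y j disj[of i j b] that by (force simp: in_keys_iff PiE_def Pi_def)
      then have "(\<Sum>i<length L. Poly_Mapping.lookup (y i) b) = (\<Sum>i\<in>{j}. Poly_Mapping.lookup (y i) b)"
        using j by (intro sum.mono_neutral_right) auto
      then show ?thesis by (simp add: lookup_sum)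
    qed
    have "inj_on (\<lambda>y. \<Sum>i<length L. y i) (\<Pi>\<^sub>E i\<in>{..<length L}. ?S i)"
    proof (rule inj_onI)
      fix y z :: "nat \<Rightarrow> ('n, 'k) pring"
      assume yz: "y \<in> (\<Pi>\<^sub>E i\<in>{..<length L}. ?S i)" "z \<in> (\<Pi>\<^sub>E i\<in>{..<length L}. ?S i)"
        and eq: "(\<Sum>i<length L. y i) = (\<Sum>i<length L. z i)"
      show "y = z"
      proof (rule PiE_ext[OF yz], rule poly_mapping_eqI)
        fix i b assume "i \<in> {..<length L}"
        then have i: "i < length L" by simp
        show "Poly_Mapping.lookup (y i) b = Poly_Mapping.lookup (z i) b"
        proof (cases "b \<in> ?C i")
          case True
          then show ?thesis using coeff[OF yz(1) i] coeff[OF yz(2) i] eq by metis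
        next
          case False
          then have "b \<notin> Poly_Mapping.keys (y i)" "b \<notin> Poly_Mapping.keys (z i)"
            using yz i by (force simp: PiE_def Pi_def)+
          then show ?thesis by (simp add: in_keys_iff)
        qed
      qed
    qed
    moreover have "(\<Sum>i<length L. y i) \<in> I" if y: "y \<in> (\<Pi>\<^sub>E i\<in>{..<length L}. ?S i)" for y
    proof (rule M.subspace_sum[OF M.submodule])
      fix i assume i: "i \<in> {..<length L}"
      then have "Poly_Mapping.keys (y i) \<subseteq> ?C i" using y by (auto simp: PiE_def Pi_def)
      then show "y i \<in> I" using i sub[of "L ! i"] monomial_ideal_mem_iff[OF I, of "y i"] by auto
    qed
    moreover have "f \<in> (\<lambda>y. \<Sum>i<length L. y i) ` (\<Pi>\<^sub>E i\<in>{..<length L}. ?S i)" if f: "f \<in> I" for f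
    proof
      \<comment> \<open>The preimage of \<open>f\<close> consists of its restrictions to the cones;
        \<open>restrict\<close> makes it extensional, as the product set demands.\<close>
      let ?y = "restrict (\<lambda>i. trunc (?C i) f) {..<length L}"
      show y: "?y \<in> (\<Pi>\<^sub>E i\<in>{..<length L}. ?S i)" by (auto simp: keys_trunc)
      show "f = (\<Sum>i<length L. ?y i)"
      proof (rule poly_mapping_eqI)
        fix b
        show "Poly_Mapping.lookup f b = Poly_Mapping.lookup (\<Sum>i<length L. ?y i) b"
        proof (cases "b \<in> Poly_Mapping.keys f")
          case True
          then have "xpow b \<in> I" using monomial_ideal_mem_iff[OF I] f by blast
          then obtain j where j: "j < length L" "b \<in> ?C j" using cover by blast
          then show ?thesis using coeff[OF y j] by (simp add: lookup_trunc)
        next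
          case False
          then show ?thesis by (simp add: lookup_sum lookup_trunc in_keys_iff cong: if_cong)
        qed
      qed
    qed
    ultimately show ?thesis unfolding bij_betw_def by blast
  qed
  have eq: "(\<Pi>\<^sub>E i\<in>{..<length L}. M.stanley_span (fst (map (\<lambda>p. (xpow (apex p), snd p)) L ! i))
      (snd (map (\<lambda>p. (xpow (apex p), snd p)) L ! i))) = (\<Pi>\<^sub>E i\<in>{..<length L}. ?S i)"
    by (auto intro!: PiE_cong simp: stanley_span_apex)
  show ?thesis
    unfolding M.stanley_decomposition_def length_map eq
    by (intro conjI spaces bij)
qed

section \<open>The lower bound for the Stanley depth\<close>

lemma sdepth_of_le_sdepth:
  assumes "M.stanley_decomposition D"
  shows "M.sdepth_of D \<le> M.sdepth"
proof -
  \<comment> \<open>A uniform bound makes the set of depths finite, so that its \<open>Max\<close>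
    dominates each member.\<close>
  have "M.sdepth_of E \<le> CARD('n)" if E: "M.stanley_decomposition E" for E
  proof -
    \<comment> \<open>The empty list sums only to 0 and \<open>I\<close> is nonzero;
      \<open>Min\<close> of an empty set would give no bound.\<close>
    have "E \<noteq> []"
    proof
      assume "E = []"
      then show False using E ne by (auto simp: M.stanley_decomposition_def bij_betw_def)
    qed
    then obtain p where p: "p \<in> set E" by (cases E) auto
    have "M.sdepth_of E \<le> (case p of (u, Z) \<Rightarrow> card Z)"
      unfolding M.sdepth_of_def using p by (intro Min_le) auto
    also have "\<dots> \<le> CARD('n)" by (auto split: prod.split intro: card_mono)
    finally show ?thesis .
  qed
  then have "{M.sdepth_of D | D. M.stanley_decomposition D} \<subseteq> {..CARD('n)}" by blast
  then have "finite {M.sdepth_of D | D. M.stanley_decomposition D}"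
    by (rule finite_subset) simp
  then show ?thesis unfolding M.sdepth_def using assms by (intro Max_ge) blast+
qed

lemma sdepth_ideal_ge:
  "max 1 (int CARD('n) - int (card G) + 1) \<le> int (sdepth_ideal I)"
proof -
  let ?E = "{b. xpow b \<in> I}"
  let ?A = "Poly_Mapping.lookup ` min_exps ?E"
  have fin: "finite (min_exps ?E)" and card: "card (min_exps ?E) \<le> card G"
    using card_min_exps_le[OF I G gen] by auto
  obtain f where f: "f \<in> I" "f \<noteq> 0" using ne M.subspace_0[OF M.submodule] by blast
  then obtain b where "b \<in> Poly_Mapping.keys f" by (metis poly_mapping_eqI in_keys_iff lookup_zero)
  then have "b \<in> ?E" using monomial_ideal_mem_iff[OF I] f by blast
  then have ne': "min_exps ?E \<noteq> {}" using min_exps_below[of b ?E] by blast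
  have up: "xpow (c + a) \<in> I" if "xpow a \<in> I" for a c
    using ideal_mult[OF gen that, of "xpow c"] by (simp add: xpow_def mult_single)
  \<comment> \<open>Over all variables nothing is frozen, so \<open>w\<close> is arbitrary and the
    slice is the exponent set of \<open>I\<close>.\<close>
  have E: "slice UNIV w ?A = Poly_Mapping.lookup ` ?E" for w
  proof (intro set_eqI iffI)
    fix h assume "h \<in> slice UNIV w ?A"
    then obtain a where a: "a \<in> min_exps ?E" "\<And>i. Poly_Mapping.lookup a i \<le> h i" by (auto simp: slice_def)
    have "xpow (Abs_poly_mapping (\<lambda>i. h i - Poly_Mapping.lookup a i) + a) \<in> I"
      using a by (intro up) (simp add: min_exps_def)
    moreover have "h = Poly_Mapping.lookup (Abs_poly_mapping (\<lambda>i. h i - Poly_Mapping.lookup a i) + a)"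
      using a by (auto simp: lookup_add)
    ultimately show "h \<in> Poly_Mapping.lookup ` ?E" by blast
  next
    fix h assume "h \<in> Poly_Mapping.lookup ` ?E"
    then obtain e where "e \<in> ?E" "h = Poly_Mapping.lookup e" by blast
    then obtain a c where "a \<in> min_exps ?E" "h = Poly_Mapping.lookup (c + a)"
      using min_exps_below[of e ?E] by blast
    then show "h \<in> slice UNIV w ?A" by (auto simp: slice_def lookup_add intro!: bexI[of _ a])
  qed
  obtain D where D: "cone_partition D (Poly_Mapping.lookup ` ?E)"
    and dim: "\<forall>p\<in>D. snd p \<subseteq> UNIV \<and> 1 \<le> card (snd p) \<and> CARD('n) + 1 \<le> card (snd p) + card ?A"
    using slice_cone_partition[of UNIV ?A] fin ne' unfolding E by auto
  have "finite D" using D by (simp add: cone_partition_def)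
  then obtain L where L: "set L = D" "distinct L" using finite_distinct_list by blast
  let ?L = "map (\<lambda>p. (xpow (apex p) :: ('n, 'k) pring, snd p)) L"
  have dec: "M.stanley_decomposition ?L" using stanley_decomposition_cones[of L] L D by simp
  \<comment> \<open>Nonemptiness lets \<open>Min\<close> be attained at some cone, to which the
    dimension bound applies.\<close>
  have "D \<noteq> {}" using D \<open>b \<in> ?E\<close> unfolding cone_partition_def by blast
  then have "M.sdepth_of ?L \<in> (\<lambda>(u, Z). card Z) ` set ?L"
    unfolding M.sdepth_of_def using L by (intro Min_in) auto
  then obtain p where "p \<in> D" "M.sdepth_of ?L = card (snd p)" using L by auto
  moreover have "card ?A \<le> card G" using card card_image_le[OF fin] le_trans by blast
  ultimately have "max 1 (int CARD('n) - int (card G) + 1) \<le> int (M.sdepth_of ?L)"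
    using dim by fastforce
  then show ?thesis using sdepth_of_le_sdepth[OF dec] by linarith
qed

end

theorem proposition3p4:
  fixes I G :: "('n::finite, 'k::field) pring set" and m :: nat
  assumes "monomial_ideal I" and "I \<noteq> {0}"
    and "finite G" and "card G = m" and "I = ideal_gen G"
  shows "int (sdepth_ideal I) \<ge> max 1 (int CARD('n) - int m + 1)"
  using sdepth_ideal_ge[OF assms(1-3,5)] unfolding assms(4) .

end
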